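(* Let $k\ge 1$ be an integer. (a) For every $n$ with $3\le n\le\infty$ (that is, $n\geq 3$ an integer or $n=\infty$), the digraph $\mathbb{Z}(\Theta_n,k)$ is sharply $k$-arc-transitive. (b) Let $\Delta$ be a connected stable digraph with vertex set $V$. Assume that whenever $(v,w)$ is an arc in $\Delta$ then $(w,v)$ is also an arc in $\Delta$. If $\mathrm{CDHC}(\Delta)$ is arc-transitive, then $\mathbb{Z}(\Delta,k)$ is sharply $k$-arc-transitive.
   Context: A digraph $\Gamma$ is a pair $(\mathrm V\Gamma,\mathrm E\Gamma)$ with $\mathrm E\Gamma\subseteq \mathrm V\Gamma\times \mathrm V\Gamma$ the set of arcs (loops are allowed, both $(v,w)$ and $(w,v)$ may be arcs, and $\mathrm V\Gamma$ may be infinite). A digraph is connected if its underlying undirected graph is connected. An automorphism of $\Gamma$ is a bijection of $\mathrm V\Gamma$ that preserves arcs and non-arcs. A $k$-arc is a sequence $(v_0,\dots,v_k)$ of vertices with $(v_{i-1},v_i)$ an arc for $1\le i\le k$. $\Gamma$ is $k$-arc-transitive if $\mathrm{Aut}(\Gamma)$ acts transitively on the set of $k$-arcs; arc-transitive means $1$-arc-transitive; sharply $k$-arc-transitive means $k$-arc-transitive but not $(k+1)$-arc-transitive. For a digraph $\Delta$ with vertex set $V$ and a positive integer $k$, $\mathbb{Z}(\Delta,k)$ is the digraph with vertex set $\mathbb{Z}\times V^k$ in which the out-neighbours of $(i;v_0,\dots,v_{k-1})$ are the vertices $(i+1;w_0,\dots,w_{k-1})$ such that $v_j=w_j$ if $j\not\equiv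 i \pmod k$, and $(v_j,w_j)\in \mathrm E\Delta$ if $j\equiv i\pmod k$. The canonical double half-cover $\mathrm{CDHC}(\Delta)$ is the digraph with vertex set $V\times\{0,1\}$ whose arcs are exactly the pairs $((x,0),(y,1))$ with $(x,y)\in \mathrm E\Delta$. A digraph $\Delta$ is stable if for each $x\in \mathrm V\Delta$ the pair $\{(x,0),(x,1)\}$ is a block of imprimitivity of $\mathrm{Aut}(\mathrm{CDHC}(\Delta))$, where a set $A$ is a block of imprimitivity for a group $G$ if for every $g\in G$ either $A^g=A$ or $A\cap A^g=\emptyset$. For an integer $n\geq 3$, $\Theta_n$ is the directed cycle of length $n$ with a loop attached at every vertex (vertex set $\mathbb{Z}_n$, arcs $(x,x)$ and $(x,x+1)$). $\Theta_\infty$ is the infinite directed line with a loop attached at every vertex (vertex set $\mathbb{Z}$, arcs $(x,x)$ and $(x,x+1)$).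
   Formalization: In (b), Δ is additionally assumed to have at least three vertices (or infinitely many); the claim is false for a single vertex with or without a loop and for K_2, the only smaller nonempty digraphs meeting the hypotheses. *)

theory Defs
  imports
    "Graph_Theory.Pair_Digraph"
    "Graph_Theory.Vertex_Walk"
    "Graph_Theory.Digraph_Component"
    "HOL-Library.Extended_Nat"
begin

text \<open>
  A digraph is a \<^typ>\<open>'a pair_pre_digraph\<close> satisfying \<^const>\<open>pair_wf_digraph\<close>: a vertex set together
  with a set of ordered pairs of vertices, loops allowed, no finiteness required. The library's
  \<^const>\<open>Digraph_Component.connected\<close> refers to the underlying undirected graph.
\<close>

text \<open>Only the values on the vertex set are relevant; an automorphism is arbitrary elsewhere.\<close>

definition automorphisms :: "'a pair_pre_digraph \<Rightarrow> ('a \<Rightarrow> 'a) set" where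
  "automorphisms G =
     {g. bij_betw g (pverts G) (pverts G) \<and>
         (\<forall>u\<in>pverts G. \<forall>v\<in>pverts G. (g u, g v) \<in> parcs G \<longleftrightarrow> (u, v) \<in> parcs G)}"

definition is_k_arc :: "'a pair_pre_digraph \<Rightarrow> nat \<Rightarrow> 'a list \<Rightarrow> bool" where
  "is_k_arc G k p \<longleftrightarrow> vwalk p (with_proj G) \<and> length p = k + 1"

definition k_arc_transitive :: "nat \<Rightarrow> 'a pair_pre_digraph \<Rightarrow> bool" where
  "k_arc_transitive k G \<longleftrightarrow>
     (\<forall>p q. is_k_arc G k p \<longrightarrow> is_k_arc G k q \<longrightarrow> (\<exists>g\<in>automorphisms G. map g p = q))"

definition arc_transitive :: "'a pair_pre_digraph \<Rightarrow> bool" where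
  "arc_transitive G \<longleftrightarrow> k_arc_transitive 1 G"

definition sharply_k_arc_transitive :: "nat \<Rightarrow> 'a pair_pre_digraph \<Rightarrow> bool" where
  "sharply_k_arc_transitive k G \<longleftrightarrow> k_arc_transitive k G \<and> \<not> k_arc_transitive (k + 1) G"

text \<open>The digraph $\mathbb{Z}(\Delta,k)$; elements of $V^k$ are lists of length \<open>k\<close> over \<open>V\<close>.\<close>

definition Z_digraph :: "'a pair_pre_digraph \<Rightarrow> nat \<Rightarrow> (int \<times> 'a list) pair_pre_digraph" where
  "Z_digraph D k =
     (let W = {vs. length vs = k \<and> set vs \<subseteq> pverts D} in
      \<lparr> pverts = UNIV \<times> W,
        parcs = {((i, vs), (i + 1, ws)) | i vs ws. vs \<in> W \<and> ws \<in> W \<and>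
                   (\<forall>j<k. if int j mod int k = i mod int k
                          then (vs ! j, ws ! j) \<in> parcs D
                          else vs ! j = ws ! j)} \<rparr>)"

definition CDHC :: "'a pair_pre_digraph \<Rightarrow> ('a \<times> nat) pair_pre_digraph" where
  "CDHC D = \<lparr> pverts = pverts D \<times> {0, 1},
              parcs = {((x, 0), (y, 1)) | x y. (x, y) \<in> parcs D} \<rparr>"

definition block_of_imprimitivity :: "('a \<Rightarrow> 'a) set \<Rightarrow> 'a set \<Rightarrow> bool" where
  "block_of_imprimitivity H A \<longleftrightarrow> (\<forall>g\<in>H. g ` A = A \<or> A \<inter> g ` A = {})"

definition stable_digraph :: "'a pair_pre_digraph \<Rightarrow> bool" where
  "stable_digraph D \<longleftrightarrow>
     (\<forall>x\<in>pverts D. block_of_imprimitivity (automorphisms (CDHC D)) {(x, 0), (x, 1)})"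

text \<open>$\Theta_n$, with the residues modulo \<open>n\<close> represented by \<open>0, \<dots>, n - 1\<close>, and $\Theta_\infty$.\<close>

definition Theta :: "enat \<Rightarrow> int pair_pre_digraph" where
  "Theta n = (case n of
     enat m \<Rightarrow>
       \<lparr> pverts = {0..<int m},
         parcs = {(x, x) | x. x \<in> {0..<int m}} \<union> {(x, (x + 1) mod int m) | x. x \<in> {0..<int m}} \<rparr>
   | \<infinity> \<Rightarrow>
       \<lparr> pverts = UNIV,
         parcs = {(x, x) | x. True} \<union> {(x, x + 1) | x. True} \<rparr>)"

end

theory Submission
  imports Defs "HOL-Combinatorics.Transposition"
begin

text \<open>Along a \<open>k\<close>-arc every coordinate is changed exactly once, so a \<open>k\<close>-arc is a starting level
  together with \<open>k\<close> arcs of $\Delta$. Hence \<open>k\<close>-arc-transitivity follows once every pair of arcs of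
  $\Delta$ is related by a sequence of permutations $g_t$ such that $(x,y)$ is an arc iff
  $(g_t x, g_{t+1} y)$ is: one applies such sequences to the coordinates independently, $g_t$ acting
  where the coordinate has been changed \<open>t\<close> times. For $\Theta_n$ these are the translations and the maps
  $x \mapsto c + t - x$; for symmetric $\Delta$ they alternate between the actions of an automorphism
  of $\mathrm{CDHC}(\Delta)$ on the two halves.

  Along a $(k+1)$-arc one coordinate is changed twice, from \<open>v\<close> to \<open>w\<close> to \<open>u\<close>. Whether
  $N^+(v) = N^-(u)$ is determined by the existence of walks of length \<open>k\<close> between neighbours of the
  ends of the arc, hence it is invariant under automorphisms, and both answers occur. For
  symmetric $\Delta$ the answer is yes for $u = v$ and no otherwise, because stability excludes distinct
  vertices with the same neighbourhood.\<close>

section \<open>Walks of length at most \<open>k\<close> in Z(Delta, k)\<close>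

abbreviation tuples :: "'a pair_pre_digraph \<Rightarrow> nat \<Rightarrow> 'a list set" where
  "tuples D k \<equiv> {vs. length vs = k \<and> set vs \<subseteq> pverts D}"

lemma pverts_Z: "pverts (Z_digraph D k) = UNIV \<times> tuples D k"
  by (simp add: Z_digraph_def Let_def)

lemma parcs_Z:
  "((i, vs), (i', ws)) \<in> parcs (Z_digraph D k) \<longleftrightarrow>
     i' = i + 1 \<and> vs \<in> tuples D k \<and> ws \<in> tuples D k \<and>
     (\<forall>j<k. if int j mod int k = i mod int k then (vs ! j, ws ! j) \<in> parcs D else vs ! j = ws ! j)"
  by (auto simp: Z_digraph_def Let_def)

lemma parcs_Z_verts: "parcs (Z_digraph D k) \<subseteq> pverts (Z_digraph D k) \<times> pverts (Z_digraph D k)"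
  by (auto simp: Z_digraph_def Let_def)

lemma is_k_arc_iff:
  "is_k_arc G k p \<longleftrightarrow>
     length p = k + 1 \<and> set p \<subseteq> pverts G \<and> (\<forall>t<k. (p ! t, p ! Suc t) \<in> parcs G)"
proof (induction k arbitrary: p)
  case 0
  then show ?case
    by (cases p) (auto simp: is_k_arc_def vwalk_def)
next
  case (Suc k)
  show ?case
  proof (cases "length p = Suc (Suc k)")
    case True
    then obtain x y q where p: "p = x # y # q"
      by (metis length_Suc_conv)
    have "is_k_arc G (Suc k) p \<longleftrightarrow> x \<in> pverts G \<and> (x, y) \<in> parcs G \<and> is_k_arc G k (y # q)"
      using True by (auto simp: p is_k_arc_def vwalk_def arcs_ends_def arc_to_ends_def)
    then show ?thesis
      using True unfolding Suc.IH by (auto simp: p All_less_Suc2)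
  next
    case False
    then show ?thesis by (auto simp: is_k_arc_def)
  qed
qed

lemma relpow_nth:
  assumes "\<And>t. t < k \<Longrightarrow> (p ! t, p ! Suc t) \<in> A" "s + t \<le> k"
  shows "(p ! s, p ! (s + t)) \<in> A ^^ t"
  using assms(2)
proof (induction t)
  case (Suc t)
  then show ?case using assms(1)[of "s + t"] by auto
qed simp

lemma k_arc_relpow:
  assumes "is_k_arc G k p" "s + t \<le> k"
  shows "(p ! s, p ! (s + t)) \<in> parcs G ^^ t"
  using assms by (intro relpow_nth[of k]) (auto simp: is_k_arc_iff)

lemma relpow_k_arc:
  assumes "(a, b) \<in> parcs G ^^ k" "parcs G \<subseteq> pverts G \<times> pverts G" "a \<in> pverts G"
  obtains p where "is_k_arc G k p" "p ! 0 = a" "p ! k = b"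
proof -
  from assms(1) obtain f where f: "f 0 = a" "f k = b" "\<And>i. i < k \<Longrightarrow> (f i, f (Suc i)) \<in> parcs G"
    by (auto simp: relpow_fun_conv)
  have v: "f i \<in> pverts G" if "i \<le> k" for i
    using that f(1) f(3)[of "i - 1"] assms(2,3) by (cases i) auto
  show thesis
  proof
    show "is_k_arc G k (map f [0..<Suc k])"
      using f(3) v by (auto simp: is_k_arc_iff nth_append simp del: upt_Suc)
  qed (use f in \<open>auto simp del: upt_Suc\<close>)
qed

text \<open>The residue \<open>(int j - i) mod int k\<close> is the waiting time of coordinate
  \<open>j\<close> at level \<open>i\<close>: with steps numbered from 0, it is the step that
  changes \<open>j\<close>. The descriptions of walks below are phrased with this residue.\<close>

lemma residue_eq_iff:
  assumes "n < k"
  shows "int j mod int k = (i + int n) mod int k \<longleftrightarrow> (int j - i) mod int k = int n"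
proof -
  have "int j mod int k = (i + int n) mod int k \<longleftrightarrow> (int j - i) mod int k = int n mod int k"
    by (simp add: mod_eq_dvd_iff algebra_simps)
  then show ?thesis using assms by simp
qed

text \<open>The bound \<open>n \<le> k\<close> makes the levels passed have distinct residues, so
  each coordinate is changed at most once, namely when its waiting time is below \<open>n\<close>.
  Beyond \<open>k\<close> steps a coordinate would change twice.\<close>

lemma relpow_Z:
  assumes "n \<le> k" "vs \<in> tuples D k"
  shows "((i, vs), (i', ws)) \<in> parcs (Z_digraph D k) ^^ n \<longleftrightarrow>
     i' = i + int n \<and> ws \<in> tuples D k \<and>
     (\<forall>j<k. if (int j - i) mod int k < int n then (vs ! j, ws ! j) \<in> parcs D else vs ! j = ws ! j)"
  using assms(1)
proof (induction n arbitrary: i' ws)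
  case 0
  have "\<not> (int j - i) mod int k < 0" if "j < k" for j
    using that by (simp add: not_less)
  then show ?case
    using assms(2) by (auto intro: nth_equalityI)
next
  case (Suc n)
  let ?r = "\<lambda>j. (int j - i) mod int k"
  have r: "int j mod int k = (i + int n) mod int k \<longleftrightarrow> ?r j = int n" for j
    using Suc.prems by (intro residue_eq_iff) simp
  have IH: "((i, vs), (i'', us)) \<in> parcs (Z_digraph D k) ^^ n \<longleftrightarrow>
     i'' = i + int n \<and> us \<in> tuples D k \<and>
     (\<forall>j<k. if ?r j < int n then (vs ! j, us ! j) \<in> parcs D else vs ! j = us ! j)" for i'' us
    using Suc by simp
  show ?case
  proof
    assume "((i, vs), (i', ws)) \<in> parcs (Z_digraph D k) ^^ Suc n"
    then obtain us where us: "((i, vs), (i + int n, us)) \<in> parcs (Z_digraph D k) ^^ n"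
      "((i + int n, us), (i', ws)) \<in> parcs (Z_digraph D k)"
      by (auto simp: IH)
    have "if ?r j < int (Suc n) then (vs ! j, ws ! j) \<in> parcs D else vs ! j = ws ! j"
      if "j < k" for j
    proof -
      have "if ?r j < int n then (vs ! j, us ! j) \<in> parcs D else vs ! j = us ! j"
        using us(1) that unfolding IH by blast
      moreover have "if ?r j = int n then (us ! j, ws ! j) \<in> parcs D else us ! j = ws ! j"
        using us(2) that unfolding parcs_Z r by blast
      ultimately show ?thesis by (auto split: if_splits)
    qed
    moreover have "i' = i + int (Suc n)" "ws \<in> tuples D k"
      using us(2) unfolding parcs_Z by auto
    ultimately show "i' = i + int (Suc n) \<and> ws \<in> tuples D k \<and>
     (\<forall>j<k. if ?r j < int (Suc n) then (vs ! j, ws ! j) \<in> parcs D else vs ! j = ws ! j)"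
      by blast
  next
    assume R: "i' = i + int (Suc n) \<and> ws \<in> tuples D k \<and>
     (\<forall>j<k. if ?r j < int (Suc n) then (vs ! j, ws ! j) \<in> parcs D else vs ! j = ws ! j)"
    \<comment> \<open>The witness for the last tuple but one: coordinates already due carry their
      final value, the others their initial one.\<close>
    define us where "us = map (\<lambda>j. if ?r j < int n then ws ! j else vs ! j) [0..<k]"
    have us: "us \<in> tuples D k"
      using R assms(2) by (auto simp: us_def subset_iff)
    have R3: "if ?r j < int (Suc n) then (vs ! j, ws ! j) \<in> parcs D else vs ! j = ws ! j"
      if "j < k" for j
      using R that by blast
    have "((i, vs), (i + int n, us)) \<in> parcs (Z_digraph D k) ^^ n"
      unfolding IH
    proof (intro conjI allI impI)
      fix j assume "j < k"
      then show "if ?r j < int n then (vs ! j, us ! j) \<in> parcs D else vs ! j = us ! j"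
        using R3[of j] by (auto simp: us_def split: if_splits)
    qed (use us in auto)
    moreover have "((i + int n, us), (i', ws)) \<in> parcs (Z_digraph D k)"
      unfolding parcs_Z r
    proof (intro conjI allI impI)
      fix j assume "j < k"
      then show "if ?r j = int n then (us ! j, ws ! j) \<in> parcs D else us ! j = ws ! j"
        using R3[of j] by (auto simp: us_def split: if_splits)
    qed (use us R in auto)
    ultimately show "((i, vs), (i', ws)) \<in> parcs (Z_digraph D k) ^^ Suc n"
      by auto
  qed
qed

lemma relpow_Z_full:
  assumes "k \<ge> 1" "vs \<in> tuples D k"
  shows "((i, vs), (i', ws)) \<in> parcs (Z_digraph D k) ^^ k \<longleftrightarrow>
     i' = i + int k \<and> ws \<in> tuples D k \<and> (\<forall>j<k. (vs ! j, ws ! j) \<in> parcs D)"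
proof -
  have "(int j - i) mod int k < int k" for j
    using assms(1) by simp
  then show ?thesis
    using relpow_Z[OF order.refl assms(2), of i i' ws] by simp
qed

text \<open>A \<open>k\<close>-arc is determined by its two ends. The walk from the start to
  position \<open>t\<close> and the walk from there to the end share the turns of all coordinates,
  each turn falling into just one of them; the other walk fixes the value of that
  coordinate.\<close>

lemma k_arc_Z:
  assumes k: "k \<ge> 1" and p: "is_k_arc (Z_digraph D k) k p"
  obtains i vs ws where "vs \<in> tuples D k" "ws \<in> tuples D k"
    "\<forall>j<k. (vs ! j, ws ! j) \<in> parcs D"
    "p = map (\<lambda>t. (i + int t, map (\<lambda>j. if (int j - i) mod int k < int t then ws ! j else vs ! j) [0..<k]))
           [0..<Suc k]"
proof -
  obtain i vs where iv: "p ! 0 = (i, vs)" by force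
  obtain i' ws where iw: "p ! k = (i', ws)" by force
  have len: "length p = Suc k" and pv: "set p \<subseteq> pverts (Z_digraph D k)"
    using p by (auto simp: is_k_arc_iff)
  have "p ! 0 \<in> pverts (Z_digraph D k)"
    using pv len by (intro subsetD[OF pv] nth_mem) auto
  then have vs: "vs \<in> tuples D k" by (simp add: iv pverts_Z)
  have E: "i' = i + int k" "ws \<in> tuples D k" "\<forall>j<k. (vs ! j, ws ! j) \<in> parcs D"
    using k_arc_relpow[OF p, of 0 k] unfolding iv iw by (simp_all add: relpow_Z_full[OF k vs] iv iw)
  have nth: "p ! t = (i + int t, map (\<lambda>j. if (int j - i) mod int k < int t then ws ! j else vs ! j) [0..<k])"
    if t: "t \<le> k" for t
  proof -
    obtain l us where pt: "p ! t = (l, us)" by force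
    have 1: "l = i + int t" "us \<in> tuples D k"
      "\<forall>j<k. if (int j - i) mod int k < int t then (vs ! j, us ! j) \<in> parcs D else vs ! j = us ! j"
      using k_arc_relpow[OF p, of 0 t] t by (simp_all add: iv pt relpow_Z[OF t vs])
    have 2: "\<forall>j<k. if (int j - l) mod int k < int (k - t) then (us ! j, ws ! j) \<in> parcs D else us ! j = ws ! j"
      using k_arc_relpow[OF p, of t "k - t"] t by (simp add: iw pt relpow_Z[OF _ 1(2)])
    have "us ! j = (if (int j - i) mod int k < int t then ws ! j else vs ! j)" if j: "j < k" for j
    proof (cases "(int j - i) mod int k < int t")
      case True
      let ?r = "(int j - i) mod int k"
      have r0: "0 \<le> ?r" using k by simp
      \<comment> \<open>Seen from level \<open>l = i + int t\<close>, a coordinate already changed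
        waits \<open>?r - int t + int k\<close> steps for its next turn, which is not below the
        remaining \<open>k - t\<close>.\<close>
      have "(int j - l) mod int k = (?r - int t) mod int k"
        by (simp add: 1(1) mod_diff_left_eq algebra_simps)
      also have "\<dots> = (?r - int t + int k) mod int k" by simp
      also have "\<dots> = ?r - int t + int k"
        using True t r0 by (intro mod_pos_pos_trivial) linarith+
      finally have "\<not> (int j - l) mod int k < int (k - t)"
        using t r0 by (simp add: of_nat_diff)
      then have "us ! j = ws ! j" using 2 j by metis
      then show ?thesis using True by simp
    next
      case False
      then have "vs ! j = us ! j" using 1(3) j by metis
      then show ?thesis using False by simp
    qed
    then show ?thesis
      using 1(1,2) by (auto simp: pt intro!: nth_equalityI)
  qed
  show thesis
    by (rule that[OF vs E(2,3)], rule nth_equalityI) (use nth len in \<open>auto simp del: upt_Suc\<close>)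
qed

section \<open>Automorphisms and the level shift\<close>

lemma automorphismI:
  assumes "\<And>x. x \<in> pverts G \<Longrightarrow> g x \<in> pverts G" "\<And>x. x \<in> pverts G \<Longrightarrow> h x \<in> pverts G"
    and "\<And>x. x \<in> pverts G \<Longrightarrow> h (g x) = x" "\<And>x. x \<in> pverts G \<Longrightarrow> g (h x) = x"
    and "\<And>x y. (x, y) \<in> parcs G \<Longrightarrow> (g x, g y) \<in> parcs G"
    and "\<And>x y. (x, y) \<in> parcs G \<Longrightarrow> (h x, h y) \<in> parcs G"
  shows "g \<in> automorphisms G"
proof -
  have "bij_betw g (pverts G) (pverts G)"
    using assms by (intro bij_betw_byWitness[where f' = h]) auto
  then show ?thesis
    unfolding automorphisms_def using assms(3,5,6) by fastforce
qed

lemma automorphism_comp: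
  assumes "g \<in> automorphisms G" "h \<in> automorphisms G"
  shows "g \<circ> h \<in> automorphisms G"
proof -
  have "h x \<in> pverts G" if "x \<in> pverts G" for x
    using assms(2) that by (auto simp: automorphisms_def bij_betw_def)
  then show ?thesis
    using assms by (auto simp: automorphisms_def intro: bij_betw_trans)
qed

lemma automorphism_relpow:
  assumes "g \<in> automorphisms G" "parcs G \<subseteq> pverts G \<times> pverts G" "(a, b) \<in> parcs G ^^ n"
  shows "(g a, g b) \<in> parcs G ^^ n"
  using assms(3)
proof (induction n arbitrary: b)
  case (Suc n)
  then obtain c where c: "(a, c) \<in> parcs G ^^ n" "(c, b) \<in> parcs G" by auto
  have "(g c, g b) \<in> parcs G"
    using assms(1,2) c(2) by (auto simp: automorphisms_def)
  then show ?case using Suc.IH[OF c(1)] by auto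
qed simp

lemma automorphism_arc_inv:
  assumes "g \<in> automorphisms G" "parcs G \<subseteq> pverts G \<times> pverts G" "a \<in> pverts G"
  shows "(g a, c) \<in> parcs G \<Longrightarrow> \<exists>b. c = g b \<and> (a, b) \<in> parcs G"
    and "(c, g a) \<in> parcs G \<Longrightarrow> \<exists>b. c = g b \<and> (b, a) \<in> parcs G"
proof -
  have img: "c \<in> g ` pverts G" if "c \<in> pverts G" for c
    using assms(1) that by (auto simp: automorphisms_def bij_betw_def)
  show "\<exists>b. c = g b \<and> (a, b) \<in> parcs G" if "(g a, c) \<in> parcs G"
    using img[of c] that assms by (auto simp: automorphisms_def)
  show "\<exists>b. c = g b \<and> (b, a) \<in> parcs G" if "(c, g a) \<in> parcs G"
    using img[of c] that assms by (auto simp: automorphisms_def)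
qed

text \<open>A change of level by \<open>s\<close> must be accompanied by a cyclic rotation of the
  coordinates by \<open>s\<close>, so that the coordinate to be changed still has the residue of the
  level. These maps reduce transitivity to \<open>k\<close>-arcs that start at level 0.\<close>

definition shift :: "nat \<Rightarrow> int \<Rightarrow> int \<times> 'a list \<Rightarrow> int \<times> 'a list" where
  "shift k s = (\<lambda>(i, vs). (i + s, map (\<lambda>j. vs ! nat ((int j - s) mod int k)) [0..<k]))"

lemma nat_mod_less:
  assumes "j < k"
  shows "nat (i mod int k) < k"
  using assms by (simp add: nat_less_iff)

lemma shift_in_verts:
  assumes "x \<in> pverts (Z_digraph D k)"
  shows "shift k s x \<in> pverts (Z_digraph D k)"
proof -
  obtain i vs where x: "x = (i, vs)" by force
  have "vs ! nat (m mod int k) \<in> pverts D" if "j < k" for j m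
    using assms nat_mod_less[OF that, of m] by (auto simp: x pverts_Z)
  then show ?thesis by (auto simp: x pverts_Z shift_def)
qed

lemma shift_shift:
  assumes "x \<in> pverts (Z_digraph D k)"
  shows "shift k s (shift k (- s) x) = x"
proof -
  obtain i vs where x: "x = (i, vs)" by force
  have "map (\<lambda>j. map (\<lambda>j. vs ! nat ((int j + s) mod int k)) [0..<k] ! nat ((int j - s) mod int k)) [0..<k] = vs"
    (is "?l = vs")
  proof (rule nth_equalityI)
    fix j assume "j < length ?l"
    then have j: "j < k" by simp
    then have "int (nat ((int j - s) mod int k)) = (int j - s) mod int k" by simp
    then have "(int (nat ((int j - s) mod int k)) + s) mod int k = int j"
      using j by (simp add: mod_simps)
    then show "?l ! j = vs ! j"
      using j nat_mod_less[OF j, of "int j - s"] by simp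
  qed (use assms in \<open>simp add: x pverts_Z\<close>)
  then show ?thesis by (simp add: x shift_def)
qed

lemma shift_arc:
  assumes "(x, y) \<in> parcs (Z_digraph D k)"
  shows "(shift k s x, shift k s y) \<in> parcs (Z_digraph D k)"
proof -
  obtain i vs i' ws where xy: "x = (i, vs)" "y = (i', ws)" by force
  have in_verts: "shift k s x \<in> pverts (Z_digraph D k)" "shift k s y \<in> pverts (Z_digraph D k)"
    using assms parcs_Z_verts[of D k] by (auto intro: shift_in_verts)
  have A: "if int j mod int k = i mod int k then (vs ! j, ws ! j) \<in> parcs D else vs ! j = ws ! j"
    if "j < k" for j
    using assms that unfolding xy parcs_Z by blast
  have "if int j mod int k = (i + s) mod int k
        then (vs ! nat ((int j - s) mod int k), ws ! nat ((int j - s) mod int k)) \<in> parcs D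
        else vs ! nat ((int j - s) mod int k) = ws ! nat ((int j - s) mod int k)"
    if j: "j < k" for j
  proof -
    \<comment> \<open>Coordinate \<open>j\<close> of the image comes from coordinate
      \<open>j - s\<close>, which is due at level \<open>i\<close> exactly when \<open>j\<close> is
      due at level \<open>i + s\<close>.\<close>
    have "int j mod int k = (i + s) mod int k \<longleftrightarrow> (int j - s) mod int k = i mod int k"
      by (simp add: mod_eq_dvd_iff algebra_simps)
    moreover have "int (nat ((int j - s) mod int k)) mod int k = (int j - s) mod int k"
      using j by simp
    ultimately show ?thesis
      using A[OF nat_mod_less[OF j, of "int j - s"]] by simp
  qed
  then have B: "\<forall>j<k. if int j mod int k = (i + s) mod int k
      then (map (\<lambda>j. vs ! nat ((int j - s) mod int k)) [0..<k] ! j,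
            map (\<lambda>j. ws ! nat ((int j - s) mod int k)) [0..<k] ! j) \<in> parcs D
      else map (\<lambda>j. vs ! nat ((int j - s) mod int k)) [0..<k] ! j =
           map (\<lambda>j. ws ! nat ((int j - s) mod int k)) [0..<k] ! j"
    by (metis (no_types, lifting) add_0 diff_zero length_upt nth_map nth_upt)
  have "i' = i + 1" using assms unfolding xy parcs_Z by blast
  moreover have "map (\<lambda>j. vs ! nat ((int j - s) mod int k)) [0..<k] \<in> tuples D k"
    "map (\<lambda>j. ws ! nat ((int j - s) mod int k)) [0..<k] \<in> tuples D k"
    using in_verts unfolding xy shift_def prod.case pverts_Z by blast+
  ultimately show ?thesis
    unfolding xy shift_def prod.case parcs_Z using B by (simp only: simp_thms) simp
qed

lemma shift_automorphism: "shift k s \<in> automorphisms (Z_digraph D k)"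
proof (rule automorphismI[where h = "shift k (- s)"])
  show "shift k (- s) (shift k s x) = x" if "x \<in> pverts (Z_digraph D k)" for x
    using shift_shift[OF that, of "- s"] by simp
qed (simp_all add: shift_in_verts shift_arc shift_shift)

section \<open>Coordinatewise automorphisms and \<open>k\<close>-arc-transitivity\<close>

text \<open>The index runs over all integers because it will count the changes of a coordinate
  relative to level 0, a number that is negative far below that level.\<close>

definition arc_sequence :: "'a pair_pre_digraph \<Rightarrow> (int \<Rightarrow> 'a \<Rightarrow> 'a) \<Rightarrow> bool" where
  "arc_sequence D g \<longleftrightarrow>
     (\<forall>t. bij_betw (g t) (pverts D) (pverts D)) \<and>
     (\<forall>t. \<forall>x\<in>pverts D. \<forall>y\<in>pverts D. (g t x, g (t + 1) y) \<in> parcs D \<longleftrightarrow> (x, y) \<in> parcs D)"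

text \<open>The quotient below, the ceiling of $(i-j)/k$, counts the changes of coordinate \<open>j\<close> on the way
  from level \<open>0\<close> to level \<open>i\<close>.\<close>

definition changes :: "nat \<Rightarrow> int \<Rightarrow> nat \<Rightarrow> int" where
  "changes k i j = (i - int j + int k - 1) div int k"

text \<open>Write the numerator as \<open>k * q + r\<close> with \<open>r\<close> its remainder.
  Adding 1 raises the quotient exactly when \<open>r + 1 = k\<close>, which says that
  \<open>i\<close> and \<open>j\<close> agree modulo \<open>k\<close>.\<close>

lemma changes_Suc:
  assumes "j < k"
  shows "changes k (i + 1) j = changes k i j + (if int j mod int k = i mod int k then 1 else 0)"
proof -
  define m where "m = i - int j + int k - 1"
  define q where "q = m div int k"
  define r where "r = m mod int k"
  have qr: "m = int k * q + r" "0 \<le> r" "r < int k"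
    using assms by (auto simp: q_def r_def)
  have "int j mod int k = i mod int k \<longleftrightarrow> int k dvd i - int j"
    by (metis mod_eq_dvd_iff)
  also have "\<dots> \<longleftrightarrow> int k dvd (i - int j) + int k" by simp
  also have "(i - int j) + int k = int k * q + (r + 1)" using qr(1) by (simp add: m_def)
  also have "int k dvd \<dots> \<longleftrightarrow> int k dvd r + 1"
    by (rule dvd_add_right_iff) simp
  also have "\<dots> \<longleftrightarrow> r + 1 = int k" using qr(2,3) zdvd_imp_le[of "int k" "r + 1"] by auto
  finally have iff: "int j mod int k = i mod int k \<longleftrightarrow> r + 1 = int k" .
  have "(m + 1) div int k = q + (if r + 1 = int k then 1 else 0)"
  proof (cases "r + 1 = int k")
    case True
    then have "m + 1 = int k * (q + 1)" using qr(1) by (simp add: algebra_simps)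
    then show ?thesis using True assms by simp
  next
    case False
    then show ?thesis
      using int_div_pos_eq[of "m + 1" "int k" q "r + 1"] qr by simp
  qed
  then show ?thesis
    unfolding iff by (simp add: changes_def m_def q_def algebra_simps)
qed

text \<open>From level 0 on, coordinate \<open>j\<close> is changed in the step from level
  \<open>j\<close> to \<open>j + 1\<close>. So along a \<open>k\<close>-arc starting at level 0 only
  the permutations with index 0 and 1 act.\<close>

lemma changes_initial:
  assumes "j < k" "t \<le> k"
  shows "changes k (int t) j = (if j < t then 1 else 0)"
proof (cases "j < t")
  case True
  have "changes k (int t) j = (int t - int j - 1 + int k) div int k"
    by (simp add: changes_def algebra_simps)
  also have "\<dots> = (int t - int j - 1) div int k + 1"
    using assms by simp
  also have "(int t - int j - 1) div int k = 0"
    using assms True by (intro div_pos_pos_trivial) auto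
  finally show ?thesis using True by simp
next
  case False
  then show ?thesis
    using assms unfolding changes_def by (simp add: div_pos_pos_trivial)
qed

definition lift :: "nat \<Rightarrow> (nat \<Rightarrow> int \<Rightarrow> 'a \<Rightarrow> 'a) \<Rightarrow> int \<times> 'a list \<Rightarrow> int \<times> 'a list" where
  "lift k G = (\<lambda>(i, vs). (i, map (\<lambda>j. G j (changes k i j) (vs ! j)) [0..<k]))"

text \<open>Along an arc from level \<open>i\<close>, the coordinate that is due meets two
  consecutive permutations of its sequence, which preserve arcs and non-arcs. Every other coordinate
  meets the same permutation at both ends, so equality is preserved by injectivity.\<close>

lemma lift_automorphism:
  assumes G: "\<And>j. j < k \<Longrightarrow> arc_sequence D (G j)"
  shows "lift k G \<in> automorphisms (Z_digraph D k)"
proof -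
  let ?V = "pverts (Z_digraph D k)" and ?A = "parcs (Z_digraph D k)"
  have bij: "bij_betw (G j t) (pverts D) (pverts D)" if "j < k" for j t
    using G[OF that] by (simp add: arc_sequence_def)
  have clo: "G j t x \<in> pverts D" if "j < k" "x \<in> pverts D" for j t x
    using bij[OF that(1), of t] that(2) by (auto simp: bij_betw_def)
  have maps: "lift k G x \<in> ?V" if "x \<in> ?V" for x
    using that clo by (auto simp: pverts_Z lift_def subset_iff)
  have "inj_on (lift k G) ?V"
  proof (rule inj_onI)
    fix x y assume xy: "x \<in> ?V" "y \<in> ?V" and eq: "lift k G x = lift k G y"
    obtain i vs ws where x: "x = (i, vs)" and y: "y = (i, ws)"
      using eq by (cases x; cases y) (auto simp: lift_def)
    have W: "vs \<in> tuples D k" "ws \<in> tuples D k"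
      using xy by (simp_all add: x y pverts_Z)
    have "vs ! j = ws ! j" if "j < k" for j
    proof (rule inj_onD[OF bij_betw_imp_inj_on[OF bij[OF that]]])
      show "G j (changes k i j) (vs ! j) = G j (changes k i j) (ws ! j)"
        using eq that by (simp add: x y lift_def)
    qed (use W that in auto)
    then show "x = y"
      using W by (auto simp: x y intro: nth_equalityI)
  qed
  moreover have "y \<in> lift k G ` ?V" if "y \<in> ?V" for y
  proof -
    obtain i ws where y: "y = (i, ws)" by force
    have W: "ws \<in> tuples D k" using that by (simp add: y pverts_Z)
    \<comment> \<open>At a fixed level the index of each permutation is fixed, so a preimage can be
      taken coordinate by coordinate.\<close>
    define vs where "vs = map (\<lambda>j. inv_into (pverts D) (G j (changes k i j)) (ws ! j)) [0..<k]"
    have surj: "ws ! j \<in> G j (changes k i j) ` pverts D" if "j < k" for j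
      using bij[OF that] W that by (auto simp: bij_betw_def)
    have "vs \<in> tuples D k"
      using inv_into_into[OF surj] by (auto simp: vs_def)
    moreover have "G j (changes k i j) (vs ! j) = ws ! j" if "j < k" for j
      using f_inv_into_f[OF surj[OF that]] that by (simp add: vs_def)
    then have "lift k G (i, vs) = y"
      using W by (auto simp: y lift_def intro!: nth_equalityI)
    ultimately show ?thesis
      by (force simp: pverts_Z)
  qed
  moreover have "(lift k G x, lift k G y) \<in> ?A \<longleftrightarrow> (x, y) \<in> ?A" if xy: "x \<in> ?V" "y \<in> ?V" for x y
  proof -
    obtain i vs i' ws where x: "x = (i, vs)" and y: "y = (i', ws)" by force
    have W: "vs \<in> tuples D k" "ws \<in> tuples D k"
      using xy by (simp_all add: x y pverts_Z)
    have W': "map (\<lambda>j. G j (changes k l j) (us ! j)) [0..<k] \<in> tuples D k" if "us \<in> tuples D k" for us l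
      using that clo by (auto simp: subset_iff)
    have key: "(if int j mod int k = i mod int k
        then (G j (changes k i j) (vs ! j), G j (changes k (i + 1) j) (ws ! j)) \<in> parcs D
        else G j (changes k i j) (vs ! j) = G j (changes k (i + 1) j) (ws ! j)) \<longleftrightarrow>
      (if int j mod int k = i mod int k then (vs ! j, ws ! j) \<in> parcs D else vs ! j = ws ! j)"
      if j: "j < k" for j
    proof -
      have "vs ! j \<in> pverts D" "ws ! j \<in> pverts D" using W j by auto
      then have "(G j t (vs ! j), G j (t + 1) (ws ! j)) \<in> parcs D \<longleftrightarrow> (vs ! j, ws ! j) \<in> parcs D"
        "G j t (vs ! j) = G j t (ws ! j) \<longleftrightarrow> vs ! j = ws ! j" for t
        using G[OF j] bij_betw_imp_inj_on[OF bij[OF j, of t]]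
        unfolding arc_sequence_def by (blast, simp add: inj_on_eq_iff)
      then show ?thesis by (simp add: changes_Suc[OF j])
    qed
    have "(lift k G x, lift k G y) \<in> ?A \<longleftrightarrow> i' = i + 1 \<and>
      (\<forall>j<k. if int j mod int k = i mod int k
        then (G j (changes k i j) (vs ! j), G j (changes k (i + 1) j) (ws ! j)) \<in> parcs D
        else G j (changes k i j) (vs ! j) = G j (changes k (i + 1) j) (ws ! j))"
      using W'[OF W(1), of i] W'[OF W(2), of i'] by (auto simp: x y lift_def parcs_Z)
    also have "\<dots> \<longleftrightarrow> i' = i + 1 \<and>
      (\<forall>j<k. if int j mod int k = i mod int k then (vs ! j, ws ! j) \<in> parcs D else vs ! j = ws ! j)"
      using key by blast
    also have "\<dots> \<longleftrightarrow> (x, y) \<in> ?A"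
      using W unfolding x y parcs_Z by blast
    finally show ?thesis .
  qed
  ultimately show ?thesis
    using maps by (auto simp: automorphisms_def bij_betw_def)
qed

lemma k_arc_image:
  assumes "is_k_arc G k p" "g \<in> automorphisms G" "parcs G \<subseteq> pverts G \<times> pverts G"
  shows "is_k_arc G k (map g p)"
proof -
  have "g x \<in> pverts G" if "x \<in> pverts G" for x
    using assms(2) that by (auto simp: automorphisms_def bij_betw_def)
  then show ?thesis
    using assms automorphism_relpow[OF assms(2,3), where n = 1] by (auto simp: is_k_arc_iff)
qed

lemma Z_k_arc_transitive:
  assumes k: "k \<ge> 1"
    and trans: "\<And>x y x' y'. (x, y) \<in> parcs D \<Longrightarrow> (x', y') \<in> parcs D \<Longrightarrow>
      \<exists>g. arc_sequence D g \<and> g 0 x = x' \<and> g 1 y = y'"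
  shows "k_arc_transitive k (Z_digraph D k)"
  unfolding k_arc_transitive_def
proof (intro allI impI)
  let ?Z = "Z_digraph D k"
  have level0: "\<exists>g\<in>automorphisms ?Z. map g p = q"
    if pq: "is_k_arc ?Z k p" "is_k_arc ?Z k q" and p0: "fst (p ! 0) = 0" and q0: "fst (q ! 0) = 0"
    for p q
  proof -
    let ?mid = "\<lambda>vs ws t. map (\<lambda>j. if j < t then ws ! j else vs ! j) [0..<k]"
    have arc: "\<exists>vs ws. vs \<in> tuples D k \<and> ws \<in> tuples D k \<and> (\<forall>j<k. (vs ! j, ws ! j) \<in> parcs D) \<and>
      p = map (\<lambda>t. (int t, ?mid vs ws t)) [0..<Suc k]"
      if p: "is_k_arc ?Z k p" and p0: "fst (p ! 0) = 0" for p
    proof -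
      obtain i vs ws where *: "vs \<in> tuples D k" "ws \<in> tuples D k"
        "\<forall>j<k. (vs ! j, ws ! j) \<in> parcs D"
        "p = map (\<lambda>t. (i + int t, map (\<lambda>j. if (int j - i) mod int k < int t then ws ! j else vs ! j) [0..<k]))
           [0..<Suc k]"
        by (rule k_arc_Z[OF k p])
      \<comment> \<open>At level 0 the waiting time of coordinate \<open>j\<close> is
        \<open>j\<close> itself, so after \<open>t\<close> steps exactly the first \<open>t\<close>
        coordinates have changed.\<close>
      have "i = 0" using p0 unfolding *(4) by (simp del: upt_Suc)
      then have "p = map (\<lambda>t. (int t, ?mid vs ws t)) [0..<Suc k]"
        unfolding *(4) by (auto simp del: upt_Suc)
      then show ?thesis using * by blast
    qed
    obtain vs ws where p: "vs \<in> tuples D k" "ws \<in> tuples D k" "\<forall>j<k. (vs ! j, ws ! j) \<in> parcs D"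
      "p = map (\<lambda>t. (int t, ?mid vs ws t)) [0..<Suc k]"
      using arc[OF pq(1) p0] by blast
    obtain vs' ws' where q: "vs' \<in> tuples D k" "ws' \<in> tuples D k" "\<forall>j<k. (vs' ! j, ws' ! j) \<in> parcs D"
      "q = map (\<lambda>t. (int t, ?mid vs' ws' t)) [0..<Suc k]"
      using arc[OF pq(2) q0] by blast
    \<comment> \<open>The \<open>k\<close> arcs contained in \<open>p\<close> and in
      \<open>q\<close> are matched one by one, with an independent sequence for each
      coordinate.\<close>
    have "\<forall>j. \<exists>g. j < k \<longrightarrow> arc_sequence D g \<and> g 0 (vs ! j) = vs' ! j \<and> g 1 (ws ! j) = ws' ! j"
      using trans p(3) q(3) by blast
    from choice[OF this] obtain G
      where "\<forall>j. j < k \<longrightarrow> arc_sequence D (G j) \<and> G j 0 (vs ! j) = vs' ! j \<and> G j 1 (ws ! j) = ws' ! j"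
      by (elim exE)
    then have G: "\<And>j. j < k \<Longrightarrow> arc_sequence D (G j)"
      "\<And>j. j < k \<Longrightarrow> G j 0 (vs ! j) = vs' ! j" "\<And>j. j < k \<Longrightarrow> G j 1 (ws ! j) = ws' ! j"
      by simp_all
    have "lift k G (int t, ?mid vs ws t) = (int t, ?mid vs' ws' t)" if "t \<le> k" for t
      unfolding lift_def prod.case using that G(2,3) by (simp add: changes_initial)
    then have "map (lift k G) p = q"
      unfolding p(4) q(4) by (simp del: upt_Suc)
    then show ?thesis using lift_automorphism[of k D G, OF G(1)] by blast
  qed
  fix p q assume pq: "is_k_arc ?Z k p" "is_k_arc ?Z k q"
  define s where "s = fst (p ! 0)"
  define t where "t = fst (q ! 0)"
  have fst_shift: "fst (map (shift k m) r ! 0) = fst (r ! 0) + m" if "is_k_arc ?Z k r" for m r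
    using that by (auto simp: is_k_arc_iff shift_def split: prod.splits)
  \<comment> \<open>Both \<open>k\<close>-arcs are moved to level 0 and matched there; afterwards
    the shift of \<open>q\<close> is undone.\<close>
  have "\<exists>g\<in>automorphisms ?Z. map g (map (shift k (- s)) p) = map (shift k (- t)) q"
  proof (rule level0)
    show "fst (map (shift k (- s)) p ! 0) = 0" "fst (map (shift k (- t)) q ! 0) = 0"
      unfolding fst_shift[OF pq(1)] fst_shift[OF pq(2)] s_def t_def by simp_all
  qed (use pq in \<open>auto intro: k_arc_image[OF _ shift_automorphism parcs_Z_verts]\<close>)
  then obtain g where g: "g \<in> automorphisms ?Z" "map g (map (shift k (- s)) p) = map (shift k (- t)) q"
    by blast
  have "map (shift k t \<circ> (g \<circ> shift k (- s))) p = map (shift k t) (map (shift k (- t)) q)"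
    unfolding g(2)[symmetric] by simp
  also have "\<dots> = q"
    using pq(2) shift_shift[of _ D k t] by (auto simp: is_k_arc_iff intro!: map_idI)
  finally show "\<exists>g\<in>automorphisms ?Z. map g p = q"
    using automorphism_comp[OF shift_automorphism automorphism_comp[OF g(1) shift_automorphism]]
    by blast
qed

section \<open>An invariant of the ends of a \<open>(k+1)\<close>-arc\<close>

text \<open>A $(k+1)$-arc changes exactly one coordinate twice, say from \<open>v\<close> through \<open>w\<close> to \<open>u\<close>.
  For its two ends, the relation below says that the out-neighbours of \<open>v\<close> are exactly the
  in-neighbours of \<open>u\<close>.\<close>

definition parallel :: "'a pair_pre_digraph \<Rightarrow> nat \<Rightarrow> 'a \<Rightarrow> 'a \<Rightarrow> bool" where
  "parallel G k a d \<longleftrightarrow>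
     (\<forall>b. (a, b) \<in> parcs G \<longrightarrow> (b, d) \<in> parcs G ^^ k) \<and>
     (\<forall>c. (c, d) \<in> parcs G \<longrightarrow> (a, c) \<in> parcs G ^^ k)"

text \<open>Arcs at \<open>g a\<close> and \<open>g d\<close> are images of arcs at \<open>a\<close>
  and \<open>d\<close>, and \<open>g\<close> carries walks of length \<open>k\<close> along.\<close>

lemma parallel_automorphism:
  assumes "g \<in> automorphisms G" "parcs G \<subseteq> pverts G \<times> pverts G" "a \<in> pverts G" "d \<in> pverts G"
    and "parallel G k a d"
  shows "parallel G k (g a) (g d)"
  unfolding parallel_def
proof (intro conjI allI impI)
  fix b assume "(g a, b) \<in> parcs G"
  then show "(b, g d) \<in> parcs G ^^ k"
    using automorphism_arc_inv(1)[OF assms(1-3)] automorphism_relpow[OF assms(1,2)] assms(5)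
    unfolding parallel_def by metis
next
  fix c assume "(c, g d) \<in> parcs G"
  then show "(g a, c) \<in> parcs G ^^ k"
    using automorphism_arc_inv(2)[OF assms(1,2,4)] automorphism_relpow[OF assms(1,2)] assms(5)
    unfolding parallel_def by metis
qed

text \<open>The arc leads in \<open>k\<close> steps from the constant tuple \<open>v\<close> to the
  constant tuple \<open>w\<close>, and then changes one entry to \<open>u\<close>. All other
  coordinates only ever need the arc from \<open>v\<close> to \<open>w\<close>, so
  \<open>parallel\<close> is decided by the coordinate changed twice.\<close>

lemma Z_long_arc:
  assumes k: "k \<ge> 1" and wf: "parcs D \<subseteq> pverts D \<times> pverts D"
    and arcs: "(v, w) \<in> parcs D" "(w, u) \<in> parcs D"
  obtains p where "is_k_arc (Z_digraph D k) (k + 1) p"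
    "parallel (Z_digraph D k) k (p ! 0) (p ! (k + 1)) \<longleftrightarrow>
       (\<forall>x. (v, x) \<in> parcs D \<longleftrightarrow> (x, u) \<in> parcs D)"
proof -
  let ?Z = "Z_digraph D k"
  define vs where "vs = replicate k v"
  define ws where "ws = replicate k w"
  \<comment> \<open>Level \<open>k\<close> has residue 0, so the extra step changes coordinate
    0.\<close>
  define us where "us = ws[0 := u]"
  have W: "vs \<in> tuples D k" "ws \<in> tuples D k" "us \<in> tuples D k"
    using wf arcs by (auto simp: vs_def ws_def us_def dest!: set_update_subset_insert[THEN subsetD])
  have E: "\<forall>j<k. (vs ! j, ws ! j) \<in> parcs D"
    using arcs by (simp add: vs_def ws_def)
  have long: "((0, vs), (int k, ws)) \<in> parcs ?Z ^^ k"
    using E W by (simp add: relpow_Z_full[OF k W(1)])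
  have last: "((int k, ys), (int k + 1, us)) \<in> parcs ?Z \<longleftrightarrow>
      ys \<in> tuples D k \<and> (ys ! 0, u) \<in> parcs D \<and> (\<forall>j<k. j \<noteq> 0 \<longrightarrow> ys ! j = w)" for ys
    using W k unfolding parcs_Z by (auto simp: us_def ws_def nth_list_update split: if_splits)
  have first: "((0, vs), (1, ys)) \<in> parcs ?Z \<longleftrightarrow>
      ys \<in> tuples D k \<and> (v, ys ! 0) \<in> parcs D \<and> (\<forall>j<k. j \<noteq> 0 \<longrightarrow> ys ! j = v)" for ys
    using W k unfolding parcs_Z by (auto simp: vs_def split: if_splits)
  have "((0, vs), (int k + 1, us)) \<in> parcs ?Z ^^ (k + 1)"
    using long last[of ws] W arcs k by (auto simp: ws_def intro!: relpow_Suc_I)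
  then obtain p where p: "is_k_arc ?Z (k + 1) p" "p ! 0 = (0, vs)" "p ! (k + 1) = (int k + 1, us)"
    by (rule relpow_k_arc[OF _ parcs_Z_verts]) (use W in \<open>auto simp: pverts_Z\<close>)
  \<comment> \<open>A successor of the start differs from it at most in coordinate 0, where it has
    some out-neighbour \<open>x\<close> of \<open>v\<close>. It reaches the end in \<open>k\<close>
    steps iff \<open>(x, u)\<close> is an arc.\<close>
  have "(\<forall>b. ((0, vs), b) \<in> parcs ?Z \<longrightarrow> (b, (int k + 1, us)) \<in> parcs ?Z ^^ k) \<longleftrightarrow>
      (\<forall>x. (v, x) \<in> parcs D \<longrightarrow> (x, u) \<in> parcs D)" (is "?L \<longleftrightarrow> ?R")
  proof
    assume L: ?L
    show ?R
    proof (intro allI impI)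
      fix x assume x: "(v, x) \<in> parcs D"
      let ?ys = "vs[0 := x]"
      have ys: "?ys \<in> tuples D k"
        using W(1) x wf set_update_subset_insert[of vs 0 x] by auto
      have "((0, vs), (1, ?ys)) \<in> parcs ?Z"
        unfolding first using ys x k by (simp add: vs_def)
      then have "((1, ?ys), (int k + 1, us)) \<in> parcs ?Z ^^ k"
        using L by blast
      then have "0 < k \<longrightarrow> (?ys ! 0, us ! 0) \<in> parcs D"
        unfolding relpow_Z_full[OF k ys] by blast
      then show "(x, u) \<in> parcs D"
        using k by (simp add: us_def vs_def ws_def)
    qed
  next
    assume R: ?R
    show ?L
    proof (intro allI impI)
      fix b assume b: "((0, vs), b) \<in> parcs ?Z"
      then obtain ys where ys: "b = (1, ys)" by (cases b) (simp add: parcs_Z)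
      have f: "ys \<in> tuples D k" "(v, ys ! 0) \<in> parcs D" "\<forall>j<k. j \<noteq> 0 \<longrightarrow> ys ! j = v"
        using b unfolding ys first by blast+
      show "(b, (int k + 1, us)) \<in> parcs ?Z ^^ k"
        using f R W arcs by (auto simp: ys relpow_Z_full[OF k f(1)] us_def ws_def nth_list_update)
    qed
  qed
  \<comment> \<open>Dually, a predecessor of the end has some in-neighbour \<open>x\<close> of
    \<open>u\<close> in coordinate 0 and \<open>w\<close> elsewhere, and is reached from the start
    in \<open>k\<close> steps iff \<open>(v, x)\<close> is an arc.\<close>
  moreover have "(\<forall>c. (c, (int k + 1, us)) \<in> parcs ?Z \<longrightarrow> ((0, vs), c) \<in> parcs ?Z ^^ k) \<longleftrightarrow>
      (\<forall>x. (x, u) \<in> parcs D \<longrightarrow> (v, x) \<in> parcs D)" (is "?L \<longleftrightarrow> ?R")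
  proof
    assume L: ?L
    show ?R
    proof (intro allI impI)
      fix x assume x: "(x, u) \<in> parcs D"
      let ?ys = "ws[0 := x]"
      have ys: "?ys \<in> tuples D k"
        using W(2) x wf set_update_subset_insert[of ws 0 x] by auto
      have "((int k, ?ys), (int k + 1, us)) \<in> parcs ?Z"
        unfolding last using ys x k by (simp add: ws_def)
      then have "((0, vs), (int k, ?ys)) \<in> parcs ?Z ^^ k"
        using L by blast
      then have "0 < k \<longrightarrow> (vs ! 0, ?ys ! 0) \<in> parcs D"
        unfolding relpow_Z_full[OF k W(1)] by blast
      then show "(v, x) \<in> parcs D"
        using k by (simp add: vs_def ws_def)
    qed
  next
    assume R: ?R
    show ?L
    proof (intro allI impI)
      fix c assume c: "(c, (int k + 1, us)) \<in> parcs ?Z"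
      then obtain ys where ys: "c = (int k, ys)" by (cases c) (simp add: parcs_Z)
      have f: "ys \<in> tuples D k" "(ys ! 0, u) \<in> parcs D" "\<forall>j<k. j \<noteq> 0 \<longrightarrow> ys ! j = w"
        using c unfolding ys last by blast+
      have "(vs ! j, ys ! j) \<in> parcs D" if "j < k" for j
        using f R arcs that by (cases "j = 0") (auto simp: vs_def)
      then show "((0, vs), c) \<in> parcs ?Z ^^ k"
        using f by (auto simp: ys relpow_Z_full[OF k W(1)])
    qed
  qed
  ultimately have "parallel ?Z k (p ! 0) (p ! (k + 1)) \<longleftrightarrow>
      (\<forall>x. (v, x) \<in> parcs D \<longleftrightarrow> (x, u) \<in> parcs D)"
    unfolding parallel_def p(2,3) by blast
  then show thesis using that p(1) by blast
qed

text \<open>The \<open>(k+1)\<close>-arcs built from \<open>v, w, u\<close> and from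
  \<open>v, w, u'\<close> differ in \<open>parallel\<close>, so no automorphism takes the first to
  the second.\<close>

lemma Z_sharply_k_arc_transitive:
  assumes k: "k \<ge> 1" and wf: "parcs D \<subseteq> pverts D \<times> pverts D"
    and trans: "\<And>x y x' y'. (x, y) \<in> parcs D \<Longrightarrow> (x', y') \<in> parcs D \<Longrightarrow>
      \<exists>g. arc_sequence D g \<and> g 0 x = x' \<and> g 1 y = y'"
    and arcs: "(v, w) \<in> parcs D" "(w, u) \<in> parcs D" "(w, u') \<in> parcs D"
    and eq: "\<And>x. (v, x) \<in> parcs D \<longleftrightarrow> (x, u) \<in> parcs D"
    and neq: "\<not> (\<forall>x. (v, x) \<in> parcs D \<longleftrightarrow> (x, u') \<in> parcs D)"
  shows "sharply_k_arc_transitive k (Z_digraph D k)"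
proof -
  let ?Z = "Z_digraph D k"
  obtain p where p: "is_k_arc ?Z (k + 1) p" "parallel ?Z k (p ! 0) (p ! (k + 1))"
    using Z_long_arc[OF k wf arcs(1,2)] eq by metis
  obtain q where q: "is_k_arc ?Z (k + 1) q" "\<not> parallel ?Z k (q ! 0) (q ! (k + 1))"
    using Z_long_arc[OF k wf arcs(1,3)] neq by metis
  have len: "length p = k + 2" and pv: "set p \<subseteq> pverts ?Z"
    using p(1) by (auto simp: is_k_arc_iff)
  have "map g p \<noteq> q" if g: "g \<in> automorphisms ?Z" for g
  proof
    assume "map g p = q"
    then have "q ! 0 = g (p ! 0)" "q ! (k + 1) = g (p ! (k + 1))"
      using len by auto
    moreover have "p ! 0 \<in> pverts ?Z" "p ! (k + 1) \<in> pverts ?Z"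
      using len by (auto intro!: subsetD[OF pv])
    ultimately show False
      using parallel_automorphism[OF g parcs_Z_verts _ _ p(2)] q(2) by simp
  qed
  then have "\<not> k_arc_transitive (k + 1) ?Z"
    unfolding k_arc_transitive_def using p(1) q(1) by blast
  then show ?thesis
    using Z_k_arc_transitive[OF k trans] by (simp add: sharply_k_arc_transitive_def)
qed

section \<open>The digraphs Theta\<close>

text \<open>One modulus serves both families: \<open>m = 0\<close> stands for the infinite line,
  since \<open>x mod 0 = x\<close> and 0 divides only 0.\<close>

lemma Theta_residues:
  assumes "3 \<le> n"
  obtains m :: int where "m = 0 \<or> m \<ge> 3" "pverts (Theta n) = {x. x mod m = x}"
    "\<forall>x y. (x, y) \<in> parcs (Theta n) \<longleftrightarrow>
       x mod m = x \<and> y mod m = y \<and> (m dvd y - x \<or> m dvd y - x - 1)"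
proof (cases n)
  case (enat N)
  define m where "m = int N"
  have m: "m \<ge> 3"
    using assms by (simp add: enat m_def numeral_eq_enat)
  have range: "x \<in> {0..<m} \<longleftrightarrow> x mod m = x" for x
    using m by (auto simp: mod_pos_pos_trivial) (metis pos_mod_bound pos_mod_sign zero_less_numeral order_less_le_trans)+
  have diff: "m dvd y - x - c \<longleftrightarrow> y = (x + c) mod m" if "y mod m = y" for x y c
    using that mod_eq_dvd_iff[of y m "x + c"] by (simp add: algebra_simps)
  have Theta: "pverts (Theta n) = {0..<m}"
    "parcs (Theta n) = {(x, x) | x. x \<in> {0..<m}} \<union> {(x, (x + 1) mod m) | x. x \<in> {0..<m}}"
    by (simp_all add: Theta_def enat m_def)
  show thesis
  proof (rule that[of m])
    have "(x, y) \<in> parcs (Theta n) \<longleftrightarrow>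
       x mod m = x \<and> y mod m = y \<and> (m dvd y - x \<or> m dvd y - x - 1)" for x y
      using diff[of y x 0] diff[of y x 1] unfolding Theta(2) range by auto
    then show "\<forall>x y. (x, y) \<in> parcs (Theta n) \<longleftrightarrow>
       x mod m = x \<and> y mod m = y \<and> (m dvd y - x \<or> m dvd y - x - 1)" by blast
  qed (use m range Theta(1) in auto)
next
  case infinity
  show thesis
    by (rule that[of 0]) (auto simp: Theta_def infinity)
qed

lemma dvd_mod_diff:
  fixes m :: int
  shows "m dvd a mod m - b mod m - c \<longleftrightarrow> m dvd a - b - c"
proof -
  have "a mod m - b mod m - c = m * (b div m - a div m) + (a - b - c)"
    by (simp add: minus_mult_div_eq_mod[symmetric] algebra_simps)
  then show ?thesis by (simp only: dvd_add_right_iff dvd_triv_left)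
qed

lemma mod_affine:
  fixes m :: int
  shows "(p + e * (x mod m - q)) mod m = (p + e * (x - q)) mod m"
proof -
  have "p + e * (x mod m - q) - (p + e * (x - q)) = m * (- e * (x div m))"
    by (simp add: minus_mult_div_eq_mod[symmetric] algebra_simps)
  then show ?thesis by (simp add: mod_eq_dvd_iff)
qed

lemma Theta_sharply_k_arc_transitive:
  assumes k: "k \<ge> 1" and n: "3 \<le> n"
  shows "sharply_k_arc_transitive k (Z_digraph (Theta n) k)"
proof -
  obtain m :: int where m: "m = 0 \<or> m \<ge> 3" and V: "pverts (Theta n) = {x. x mod m = x}"
    and E: "\<And>x y. (x, y) \<in> parcs (Theta n) \<longleftrightarrow>
       x mod m = x \<and> y mod m = y \<and> (m dvd y - x \<or> m dvd y - x - 1)"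
    by (rule Theta_residues[OF n]) blast
  have small: "c = 0" if "m dvd c" "\<bar>c\<bar> < 3" for c
    using m dvd_imp_le_int[of c m] that by fastforce
  \<comment> \<open>For \<open>e = 1\<close> this is the translation taking \<open>a\<close> to
    \<open>b\<close>, the same for all \<open>t\<close>. For \<open>e = -1\<close> it is a
    reflection whose image of \<open>a\<close> advances with \<open>t\<close>.\<close>
  have seq: "arc_sequence (Theta n) (\<lambda>t z. (b + e * (z - a) + (if e = 1 then 0 else t)) mod m)"
    if e: "e = 1 \<or> e = -1" for a b e :: int
    unfolding arc_sequence_def
  proof (intro conjI allI ballI)
    fix t :: int
    define s where "s = (if e = 1 then 0 else t)"
    \<comment> \<open>The inverse at index \<open>t\<close> exchanges the base points
      \<open>a\<close> and \<open>b + s\<close>, as \<open>e\<close> is its own reciprocal.\<close>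
    have "(a + e * ((b + e * (z - a) + s) mod m - (b + s))) mod m = z mod m" for z
      using e unfolding mod_affine by auto
    moreover have "(b + e * ((a + e * (z - (b + s))) mod m - a) + s) mod m = z mod m" for z
      using e mod_affine[of "b + s" e "a + e * (z - (b + s))" m a] by (auto simp: algebra_simps)
    ultimately show "bij_betw (\<lambda>z. (b + e * (z - a) + (if e = 1 then 0 else t)) mod m)
        (pverts (Theta n)) (pverts (Theta n))"
      unfolding V s_def[symmetric]
      by (intro bij_betw_byWitness[where f' = "\<lambda>z. (a + e * (z - (b + s))) mod m"]) auto
  next
    fix t x y :: int assume "x \<in> pverts (Theta n)" "y \<in> pverts (Theta n)"
    then have V': "x mod m = x" "y mod m = y" by (simp_all add: V)
    show "((b + e * (x - a) + (if e = 1 then 0 else t)) mod m,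
           (b + e * (y - a) + (if e = 1 then 0 else t + 1)) mod m) \<in> parcs (Theta n) \<longleftrightarrow>
          (x, y) \<in> parcs (Theta n)"
    proof (cases "e = 1")
      case True
      then show ?thesis
        using dvd_mod_diff[of m "b + (y - a)" "b + (x - a)" 0] dvd_mod_diff[of m "b + (y - a)" "b + (x - a)" 1]
        by (simp add: E V')
    next
      case False
      then have "e = - 1" using e by simp
      \<comment> \<open>The index grows by 1 along an arc, so the reflections turn a difference
        \<open>c\<close> into \<open>1 - c\<close> and exchange loops with proper arcs.\<close>
      have flip: "m dvd (b + e * (y - a) + (t + 1)) mod m - (b + e * (x - a) + t) mod m - c \<longleftrightarrow>
          m dvd y - x - (1 - c)" for c
      proof -
        have "b + e * (y - a) + (t + 1) - (b + e * (x - a) + t) - c = - (y - x - (1 - c))"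
          by (simp add: \<open>e = -1\<close>)
        then show ?thesis unfolding dvd_mod_diff by (simp only: dvd_minus_iff)
      qed
      show ?thesis
        using flip[of 0] flip[of 1] False unfolding E V' by auto
    qed
  qed
  have mod1: "x mod m = x" if "0 \<le> x" "x \<le> 1" for x
    using m that by (auto simp: mod_pos_pos_trivial)
  show ?thesis
  \<comment> \<open>Here \<open>v = w = 0\<close>, \<open>u = 1\<close> and \<open>u' = 0\<close>.
    The out-neighbours of 0 and the in-neighbours of 1 are both 0 and 1, while the in-neighbours of
    0 are 0 and -1 modulo \<open>m\<close>.\<close>
  proof (rule Z_sharply_k_arc_transitive[OF k, of _ 0 0 1 0])
    show "parcs (Theta n) \<subseteq> pverts (Theta n) \<times> pverts (Theta n)"
      by (auto simp: E V)
  next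
    fix x y x' y' assume A: "(x, y) \<in> parcs (Theta n)" "(x', y') \<in> parcs (Theta n)"
    \<comment> \<open>Arcs of equal difference are related by a translation, a loop and a proper arc
      by a reflection.\<close>
    have "\<exists>e. (e = 1 \<or> e = -1) \<and> m dvd x' + e * (y - x) + (if e = 1 then 0 else 1) - y'"
    proof -
      define d where "d = y - x"
      define d' where "d' = y' - x'"
      have dd': "m dvd d \<or> m dvd d - 1" "m dvd d' \<or> m dvd d' - 1"
        using A by (simp_all add: E d_def d'_def)
      have "m dvd d - d' \<or> m dvd 1 - d - d'"
      proof (cases "m dvd d \<longleftrightarrow> m dvd d'")
        case True
        then have "m dvd d - d' \<or> m dvd (d - 1) - (d' - 1)"
          using dd' dvd_diff by blast
        then show ?thesis by simp
      next
        case False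
        then have "m dvd d + (d' - 1) \<or> m dvd (d - 1) + d'"
          using dd' dvd_add by blast
        then have "m dvd d + d' - 1" by (simp add: algebra_simps)
        moreover have "1 - d - d' = - (d + d' - 1)" by simp
        ultimately show ?thesis by (simp only: dvd_minus_iff simp_thms)
      qed
      then show ?thesis
      proof
        assume "m dvd d - d'"
        then show ?thesis
          by (intro exI[of _ 1]) (simp add: d_def d'_def algebra_simps)
      next
        assume "m dvd 1 - d - d'"
        then show ?thesis
          by (intro exI[of _ "- 1"]) (simp add: d_def d'_def algebra_simps)
      qed
    qed
    then obtain e where e: "e = 1 \<or> e = -1" "m dvd x' + e * (y - x) + (if e = 1 then 0 else 1) - y'"
      by blast
    have "(x' + e * (y - x) + (if e = 1 then 0 else 1)) mod m = y'"
      using e(2) A(2) unfolding mod_eq_dvd_iff[symmetric] by (simp add: E)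
    moreover have "(x' + e * (x - x) + (if e = 1 then 0 else 0)) mod m = x'"
      using A(2) by (simp add: E)
    ultimately show "\<exists>g. arc_sequence (Theta n) g \<and> g 0 x = x' \<and> g 1 y = y'"
      using seq[OF e(1), of x' x] by blast
  next
    show "(0, 0) \<in> parcs (Theta n)" "(0, 1) \<in> parcs (Theta n)" "(0, 0) \<in> parcs (Theta n)"
      using mod1 by (simp_all add: E)
  next
    fix x
    show "(0, x) \<in> parcs (Theta n) \<longleftrightarrow> (x, 1) \<in> parcs (Theta n)"
      using mod1 by (auto simp: E dvd_diff_commute[of m 1])
  next
    \<comment> \<open>Length at least 3 matters here: modulo 2 the pair \<open>(1, 0)\<close> would
      be an arc.\<close>
    have "\<not> m dvd 1" "\<not> m dvd 2" using small[of 1] small[of 2] by auto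
    then have "(0, 1) \<in> parcs (Theta n)" "(1, 0) \<notin> parcs (Theta n)"
      using mod1 by (auto simp: E)
    then show "\<not> (\<forall>x. (0, x) \<in> parcs (Theta n) \<longleftrightarrow> (x, 0) \<in> parcs (Theta n))"
      by blast
  qed
qed

section \<open>Symmetric stable digraphs\<close>

lemma parcs_CDHC: "((x, i), (y, j)) \<in> parcs (CDHC D) \<longleftrightarrow> i = 0 \<and> j = 1 \<and> (x, y) \<in> parcs D"
  by (auto simp: CDHC_def)

lemma pverts_CDHC: "pverts (CDHC D) = pverts D \<times> {0, 1}"
  by (simp add: CDHC_def)

text \<open>If \<open>x\<close> and \<open>x'\<close> were distinct, swapping \<open>(x, 0)\<close>
  with \<open>(x', 0)\<close> and fixing all else would be an automorphism of the double half-cover.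
  It would move \<open>(x, 0)\<close> out of its block but fix \<open>(x, 1)\<close>, against
  stability.\<close>

lemma stable_twins_eq:
  assumes stable: "stable_digraph D" and V: "x \<in> pverts D" "x' \<in> pverts D"
    and twins: "\<And>y. (x, y) \<in> parcs D \<longleftrightarrow> (x', y) \<in> parcs D"
  shows "x = x'"
proof (rule ccontr)
  assume "x \<noteq> x'"
  let ?f = "transpose (x, 0) (x', 0) :: 'a \<times> nat \<Rightarrow> 'a \<times> nat"
  have arc: "(?f a, ?f b) \<in> parcs (CDHC D)" if ab: "(a, b) \<in> parcs (CDHC D)" for a b
  proof -
    obtain u v where uv: "a = (u, 0)" "b = (v, 1)" "(u, v) \<in> parcs D"
      using ab by (auto simp: CDHC_def)
    define u' where "u' = (if u = x then x' else if u = x' then x else u)"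
    have "?f a = (u', 0)" "?f b = b"
      by (simp_all add: transpose_def uv u'_def)
    moreover have "(u', v) \<in> parcs D"
      using uv(3) twins[of v] unfolding u'_def by presburger
    ultimately show ?thesis by (simp add: uv parcs_CDHC)
  qed
  have "?f \<in> automorphisms (CDHC D)"
  proof (rule automorphismI[where h = ?f])
    show "?f z \<in> pverts (CDHC D)" "?f z \<in> pverts (CDHC D)" if "z \<in> pverts (CDHC D)" for z
      using V that by (simp_all add: transpose_def pverts_CDHC)
  qed (simp_all add: arc)
  then have "?f ` {(x, 0), (x, 1)} = {(x, 0), (x, 1)} \<or> {(x, 0), (x, 1)} \<inter> ?f ` {(x, 0), (x, 1)} = {}"
    using stable V(1) unfolding stable_digraph_def block_of_imprimitivity_def by blast
  moreover have "?f ` {(x, 0), (x, 1)} = {(x', 0), (x, 1)}"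
    by (simp add: transpose_def insert_commute)
  ultimately show False using \<open>x \<noteq> x'\<close> by auto
qed

lemma connected_symmetric_rtrancl:
  assumes "Digraph_Component.connected (with_proj D)"
    and "\<forall>v w. (v, w) \<in> parcs D \<longrightarrow> (w, v) \<in> parcs D"
    and "u \<in> pverts D" "v \<in> pverts D"
  shows "(u, v) \<in> (parcs D)\<^sup>*"
proof -
  have "parcs (mk_symmetric (with_proj D)) = parcs D"
    using assms(2) by (auto simp: parcs_mk_symmetric)
  then show ?thesis
    using assms(1,3,4)
    by (auto simp: Digraph_Component.connected_def strongly_connected_def reachable_def
        dest: rtrancl_on_rtranclI)
qed

text \<open>The bound on the size excludes a single vertex and a single undirected edge, where no
  vertex has two neighbours and the digraph Z(Delta, k) does not branch.\<close>

lemma connected_symmetric_degree: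
  assumes wf: "parcs D \<subseteq> pverts D \<times> pverts D"
    and big: "infinite (pverts D) \<or> 3 \<le> card (pverts D)"
    and conn: "Digraph_Component.connected (with_proj D)"
    and sym: "\<forall>v w. (v, w) \<in> parcs D \<longrightarrow> (w, v) \<in> parcs D"
  shows "v \<in> pverts D \<Longrightarrow> \<exists>w. (v, w) \<in> parcs D"
    and "\<exists>w u u'. (w, u) \<in> parcs D \<and> (w, u') \<in> parcs D \<and> u \<noteq> u'"
proof -
  have not_sub: "\<not> pverts D \<subseteq> {a, b}" for a b
  proof
    assume sub: "pverts D \<subseteq> {a, b}"
    then have "card (pverts D) \<le> card {a, b}" by (intro card_mono) auto
    also have "\<dots> \<le> 2" by (simp add: card_insert_if)
    finally show False using big finite_subset[OF sub] by auto
  qed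
  show deg: "\<exists>w. (v, w) \<in> parcs D" if v: "v \<in> pverts D" for v
  proof -
    obtain u where "u \<in> pverts D" "u \<noteq> v" using not_sub[of v v] by blast
    then show ?thesis
      using connected_symmetric_rtrancl[OF conn sym v, of u] by (auto elim: converse_rtranclE)
  qed
  show "\<exists>w u u'. (w, u) \<in> parcs D \<and> (w, u') \<in> parcs D \<and> u \<noteq> u'"
  proof (rule ccontr)
    assume "\<not> ?thesis"
    then have unique: "u = u'" if "(w, u) \<in> parcs D" "(w, u') \<in> parcs D" for w u u'
      using that by blast
    obtain v where v: "v \<in> pverts D" using not_sub by blast
    obtain w where w: "(v, w) \<in> parcs D" using deg[OF v] by blast
    \<comment> \<open>Without branching, a walk from \<open>v\<close> can only go back and forth
      between \<open>v\<close> and its neighbour \<open>w\<close>.\<close>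
    have "x \<in> {v, w}" if "(v, x) \<in> (parcs D)\<^sup>*" for x
      using that
    proof induction
      case (step y z)
      then show ?case using w sym unique by blast
    qed simp
    then show False
      using connected_symmetric_rtrancl[OF conn sym v] not_sub[of v w] by blast
  qed
qed

lemma CDHC_arc_sequence:
  assumes wf: "parcs D \<subseteq> pverts D \<times> pverts D"
    and sym: "\<forall>v w. (v, w) \<in> parcs D \<longrightarrow> (w, v) \<in> parcs D"
    and deg: "\<And>v. v \<in> pverts D \<Longrightarrow> \<exists>w. (v, w) \<in> parcs D"
    and f: "f \<in> automorphisms (CDHC D)"
  shows "arc_sequence D (\<lambda>t z. fst (f (z, if even t then 0 else 1)))"
proof -
  have arc: "(f (x, 0), f (y, 1)) \<in> parcs (CDHC D) \<longleftrightarrow> (x, y) \<in> parcs D"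
    if "x \<in> pverts D" "y \<in> pverts D" for x y
    using f that by (auto simp: automorphisms_def pverts_CDHC parcs_CDHC)
  have bij: "bij_betw f (pverts D \<times> {0, 1}) (pverts D \<times> {0, 1})"
    using f by (simp add: automorphisms_def pverts_CDHC)
  \<comment> \<open>By symmetry every vertex has both an out-neighbour and an in-neighbour, so
    \<open>(x, 0)\<close> is the tail and \<open>(x, 1)\<close> the head of some arc. Hence
    \<open>f\<close> cannot interchange the halves.\<close>
  have layer: "snd (f (x, 0)) = 0" "snd (f (x, 1)) = 1" if x: "x \<in> pverts D" for x
  proof -
    obtain y where y: "(x, y) \<in> parcs D" using deg[OF x] by blast
    then have "y \<in> pverts D" "(y, x) \<in> parcs D" using wf sym by auto
    then have "(f (x, 0), f (y, 1)) \<in> parcs (CDHC D)" "(f (y, 0), f (x, 1)) \<in> parcs (CDHC D)"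
      using arc x y by blast+
    then show "snd (f (x, 0)) = 0" "snd (f (x, 1)) = 1" by (auto simp: CDHC_def)
  qed
  have eq: "f (x, i) = (fst (f (x, i)), i)" if "x \<in> pverts D" "i \<in> {0, 1}" for x i
    using layer[OF that(1)] that(2) by (auto simp: prod_eq_iff)
  have bij_layer: "bij_betw (\<lambda>z. fst (f (z, i))) (pverts D) (pverts D)" if i: "i \<in> {0, 1}" for i
    unfolding bij_betw_def
  proof (intro conjI equalityI subsetI)
    show "inj_on (\<lambda>z. fst (f (z, i))) (pverts D)"
    proof (rule inj_onI)
      fix x y assume xy: "x \<in> pverts D" "y \<in> pverts D" "fst (f (x, i)) = fst (f (y, i))"
      then have "f (x, i) = f (y, i)" using eq[OF _ i] by metis
      then show "x = y"
        using bij_betw_imp_inj_on[OF bij] xy i by (auto dest: inj_onD)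
    qed
  next
    fix x assume "x \<in> (\<lambda>z. fst (f (z, i))) ` pverts D"
    then show "x \<in> pverts D"
      using bij_betwE[OF bij] i by fastforce
  next
    fix x assume "x \<in> pverts D"
    then have "(x, i) \<in> f ` (pverts D \<times> {0, 1})"
      using bij i by (auto simp: bij_betw_def)
    then obtain z where z: "z \<in> pverts D \<times> {0, 1}" "f z = (x, i)" by (metis imageE)
    obtain y j where "z = (y, j)" by force
    then have y: "y \<in> pverts D" "j \<in> {0, 1}" "f (y, j) = (x, i)" using z by simp_all
    then have "j = i" using eq[OF y(1,2)] by simp
    then show "x \<in> (\<lambda>z. fst (f (z, i))) ` pverts D"
      using y by force
  qed
  have arc': "(fst (f (x, 0)), fst (f (y, 1))) \<in> parcs D \<longleftrightarrow> (x, y) \<in> parcs D"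
    if "x \<in> pverts D" "y \<in> pverts D" for x y
    using arc[OF that] eq[OF that(1), of 0] eq[OF that(2), of 1] parcs_CDHC
    by (metis insertCI)
  \<comment> \<open>For odd \<open>t\<close> the two halves exchange roles, and symmetry of the
    digraph reverses the arc.\<close>
  have "(fst (f (x, 1)), fst (f (y, 0))) \<in> parcs D \<longleftrightarrow> (x, y) \<in> parcs D"
    if "x \<in> pverts D" "y \<in> pverts D" for x y
    using arc'[OF that(2,1)] sym by blast
  then show ?thesis
    using arc' bij_layer unfolding arc_sequence_def by auto
qed

lemma symmetric_sharply_k_arc_transitive:
  assumes k: "k \<ge> 1" and wf: "parcs D \<subseteq> pverts D \<times> pverts D"
    and big: "infinite (pverts D) \<or> 3 \<le> card (pverts D)"
    and conn: "Digraph_Component.connected (with_proj D)"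
    and stable: "stable_digraph D"
    and sym: "\<forall>v w. (v, w) \<in> parcs D \<longrightarrow> (w, v) \<in> parcs D"
    and trans: "arc_transitive (CDHC D)"
  shows "sharply_k_arc_transitive k (Z_digraph D k)"
proof -
  note deg = connected_symmetric_degree[OF wf big conn sym]
  obtain w u u' where w: "(w, u) \<in> parcs D" "(w, u') \<in> parcs D" "u \<noteq> u'"
    using deg(2) by blast
  show ?thesis
  \<comment> \<open>The first long arc returns to its starting value, \<open>v = u\<close>, where
    symmetry gives equal neighbourhoods; the second ends in another neighbour \<open>u'\<close> of
    \<open>w\<close>, and stability separates \<open>u\<close> from \<open>u'\<close>.\<close>
  proof (rule Z_sharply_k_arc_transitive[OF k wf, of u w u u'])
    fix x y x' y' assume A: "(x, y) \<in> parcs D" "(x', y') \<in> parcs D"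
    have "is_k_arc (CDHC D) 1 [(x, 0), (y, 1)]" "is_k_arc (CDHC D) 1 [(x', 0), (y', 1)]"
      using A wf by (auto simp: is_k_arc_iff pverts_CDHC parcs_CDHC)
    then obtain f where f: "f \<in> automorphisms (CDHC D)" "f (x, 0) = (x', 0)" "f (y, 1) = (y', 1)"
      using trans unfolding arc_transitive_def k_arc_transitive_def by fastforce
    show "\<exists>g. arc_sequence D g \<and> g 0 x = x' \<and> g 1 y = y'"
      by (intro exI conjI, rule CDHC_arc_sequence[OF wf sym deg(1) f(1)]) (simp_all add: f del: One_nat_def)
  next
    show "\<not> (\<forall>x. (u, x) \<in> parcs D \<longleftrightarrow> (x, u') \<in> parcs D)"
      using stable_twins_eq[OF stable, of u u'] w wf sym by blast
  qed (use w sym in blast)+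
qed

theorem theorem11:
  fixes k :: nat
  assumes "k \<ge> 1"
  shows "(\<forall>n::enat. 3 \<le> n \<longrightarrow> sharply_k_arc_transitive k (Z_digraph (Theta n) k)) \<and>
         (\<forall>D :: 'a pair_pre_digraph.
            pair_wf_digraph D \<longrightarrow>
            (infinite (pverts D) \<or> 3 \<le> card (pverts D)) \<longrightarrow>
            Digraph_Component.connected (with_proj D) \<longrightarrow>
            stable_digraph D \<longrightarrow>
            (\<forall>v w. (v, w) \<in> parcs D \<longrightarrow> (w, v) \<in> parcs D) \<longrightarrow>
            arc_transitive (CDHC D) \<longrightarrow>
            sharply_k_arc_transitive k (Z_digraph D k))"
proof (intro conjI allI impI)
  fix n :: enat assume "3 \<le> n"
  then show "sharply_k_arc_transitive k (Z_digraph (Theta n) k)"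
    by (rule Theta_sharply_k_arc_transitive[OF assms])
next
  fix D :: "'a pair_pre_digraph" assume D: "pair_wf_digraph D"
  have "parcs D \<subseteq> pverts D \<times> pverts D"
    using pair_wf_digraph.arc_fst_in_verts[OF D] pair_wf_digraph.arc_snd_in_verts[OF D] by force
  moreover assume "infinite (pverts D) \<or> 3 \<le> card (pverts D)"
    "Digraph_Component.connected (with_proj D)" "stable_digraph D"
    "\<forall>v w. (v, w) \<in> parcs D \<longrightarrow> (w, v) \<in> parcs D" "arc_transitive (CDHC D)"
  ultimately show "sharply_k_arc_transitive k (Z_digraph D k)"
    using assms by (intro symmetric_sharply_k_arc_transitive)
qed

end
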